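(* For each $n\geq 0$ let $P_n(z)=z^n+\sum_{j=1}^np_{n,j}z^{n-j}$ be a monic polynomial of degree $n$. Then, for every $n\ge1$ and all $\zeta_1,\dots,\zeta_n$, $$\det_{1\le j\le n}\left[P_0(\zeta_j),P_1(\zeta_j),\dots,P_{n-2}(\zeta_j),P_n(\zeta_j)\right]=\left(p_{n,1}+\sum_{j=1}^n\zeta_j\right)\prod_{1\le j<k\le n}(\zeta_k-\zeta_j).$$
   Context: The determinant is that of the $n\times n$ matrix whose $j$-th row is $(P_0(\zeta_j),P_1(\zeta_j),\dots,P_{n-2}(\zeta_j),P_n(\zeta_j))$, i.e. the polynomials of degrees $0,1,\dots,n-2$ and $n$ (degree $n-1$ is skipped). The coefficients $p_{n,j}$ and the points $\zeta_j$ are complex numbers. *)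

theory Defs
  imports
    Complex_Main
    "HOL-Computational_Algebra.Polynomial"
    "Jordan_Normal_Form.Determinant"
begin

text \<open>
  Matrices are indexed from 0, whereas the points \<open>\<zeta> 1, \<dots>, \<zeta> n\<close> are indexed from 1, so
  row \<open>i\<close> belongs to the point \<open>\<zeta> (i + 1)\<close>. Column \<open>k < n - 1\<close> carries the polynomial of
  index \<open>k\<close>, and the last column \<open>k = n - 1\<close> carries the one of index \<open>n\<close>.
\<close>

definition skip_matrix :: "(nat \<Rightarrow> complex poly) \<Rightarrow> (nat \<Rightarrow> complex) \<Rightarrow> nat \<Rightarrow> complex mat" where
  "skip_matrix P \<zeta> n =
     mat n n (\<lambda>(i, k). poly (P (if k < n - 1 then k else n)) (\<zeta> (i + 1)))"

end

theory Submission
  imports Defs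
begin

text \<open>
  Write \<open>x i = \<zeta> (i + 1)\<close> for the points counted from \<open>0\<close>. The Newton polynomials
  \<open>N k = (X - x 0) \<cdots> (X - x (k - 1))\<close> form a triangular system adapted to the points: \<open>N k\<close> vanishes
  at \<open>x 0, \<dots>, x (k - 1)\<close>, and a polynomial of degree at most \<open>k\<close> is a combination of \<open>N 0, \<dots>, N k\<close>
  whose coefficient at \<open>N k\<close> is its coefficient of degree \<open>k\<close>. Hence, for polynomials \<open>R k\<close> of degree
  at most \<open>k\<close>, the matrix with entries \<open>R k (x i)\<close> is a lower triangular matrix of values \<open>N k (x i)\<close>
  times an upper triangular matrix of coefficients, and its determinant is the product of the numbers
  \<open>coeff (R k) k\<close> times the Vandermonde product (\<open>det_poly_values\<close>).

  The last column has degree \<open>n\<close>, one too many. But \<open>N n\<close> vanishes at all of the points, so the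
  values do not change when \<open>P n\<close> is replaced by \<open>P n - N n\<close>. This difference has degree at most
  \<open>n - 1\<close> because both polynomials are monic, and its coefficient of degree \<open>n - 1\<close> is \<open>p n 1\<close> plus
  the sum of the points.
\<close>

definition newton_poly :: "(nat \<Rightarrow> 'a) \<Rightarrow> nat \<Rightarrow> 'a::comm_ring_1 poly" where
  "newton_poly x k = (\<Prod>i<k. [:- x i, 1:])"

lemma newton_poly_0: "newton_poly x 0 = 1"
  by (simp add: newton_poly_def)

lemma newton_poly_Suc: "newton_poly x (Suc k) = [:- x k, 1:] * newton_poly x k"
  by (simp add: newton_poly_def mult.commute)

lemma poly_newton_poly: "poly (newton_poly x k) z = (\<Prod>i<k. z - x i)"
  by (simp add: newton_poly_def poly_prod)

lemma poly_newton_poly_eq_0: "i < k \<Longrightarrow> poly (newton_poly x k) (x i) = 0"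
  by (induction k) (auto simp: newton_poly_0 newton_poly_Suc less_Suc_eq)

lemma degree_newton_poly_le: "degree (newton_poly x k) \<le> k"
proof (induction k)
  case 0
  then show ?case by (simp add: newton_poly_0)
next
  case (Suc k)
  have "degree (newton_poly x (Suc k)) \<le> degree [:- x k, 1:] + degree (newton_poly x k)"
    unfolding newton_poly_Suc by (rule degree_mult_le)
  with Suc show ?case by simp
qed

lemma coeff_newton_poly_eq_0: "k < i \<Longrightarrow> coeff (newton_poly x k) i = 0"
  by (rule coeff_eq_0) (rule order.strict_trans1[OF degree_newton_poly_le])

lemma coeff_newton_poly_top: "coeff (newton_poly x k) k = 1"
  by (induction k) (simp_all add: newton_poly_0 newton_poly_Suc coeff_newton_poly_eq_0)

lemma coeff_newton_poly_subtop:
  "coeff (newton_poly x (Suc k)) k = - (\<Sum>i<Suc k. x i)"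
proof (induction k)
  case 0
  then show ?case by (simp add: newton_poly_0 newton_poly_Suc)
next
  case (Suc k)
  have "coeff (newton_poly x (Suc (Suc k))) (Suc k)
      = coeff (newton_poly x (Suc k)) k - x (Suc k) * coeff (newton_poly x (Suc k)) (Suc k)"
    by (simp add: newton_poly_Suc[of x "Suc k"])
  with Suc show ?case by (simp add: coeff_newton_poly_top)
qed

text \<open>
  Since \<open>newton_poly x m\<close> is monic, subtracting \<open>coeff f m\<close> times it from \<open>f\<close> removes the term of degree
  \<open>m\<close>; the remaining coefficients come from the remainder, so only the one at \<open>m\<close> has a simple form.
\<close>

lemma newton_expansion:
  assumes "degree f \<le> m"
  obtains c where "f = (\<Sum>k\<le>m. smult (c k) (newton_poly x k))" "c m = coeff f m"
proof -
  have "\<exists>c. f = (\<Sum>k\<le>m. smult (c k) (newton_poly x k)) \<and> c m = coeff f m"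
    using assms
  proof (induction m arbitrary: f)
    case 0
    then obtain a where "f = [:a:]" by (auto elim: degree_eq_zeroE)
    then show ?case by (auto simp: newton_poly_0)
  next
    case (Suc m)
    define g where "g = f - smult (coeff f (Suc m)) (newton_poly x (Suc m))"
    have "coeff g i = 0" if "i > m" for i
    proof (cases "i = Suc m")
      case True
      then show ?thesis by (simp add: g_def coeff_newton_poly_top)
    next
      case False
      with that have "i > Suc m" by simp
      with Suc.prems show ?thesis
        by (simp add: g_def coeff_eq_0 coeff_newton_poly_eq_0)
    qed
    then have "degree g \<le> m" by (intro degree_le) auto
    from Suc.IH[OF this] obtain c where c: "g = (\<Sum>k\<le>m. smult (c k) (newton_poly x k))" by blast
    define d where "d = c(Suc m := coeff f (Suc m))"
    have "(\<Sum>k\<le>m. smult (d k) (newton_poly x k)) = g"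
      unfolding c by (intro sum.cong) (auto simp: d_def)
    then have "f = (\<Sum>k\<le>Suc m. smult (d k) (newton_poly x k))"
      by (simp add: g_def d_def)
    moreover have "d (Suc m) = coeff f (Suc m)" by (simp add: d_def)
    ultimately show ?case by blast
  qed
  with that show thesis by blast
qed

text \<open>
  The Newton expansions of the \<open>R k\<close> factor the matrix of values into a lower triangular factor,
  with diagonal entries \<open>(x i - x 0) \<cdots> (x i - x (i - 1))\<close>, and an upper triangular one, with diagonal
  entries \<open>coeff (R k) k\<close>. For monic \<open>R k\<close> this is Vandermonde's determinant.
\<close>

lemma det_poly_values:
  fixes R :: "nat \<Rightarrow> 'a::comm_ring_1 poly"
  assumes deg: "\<And>k. k < n \<Longrightarrow> degree (R k) \<le> k"
  shows "det (mat n n (\<lambda>(i, k). poly (R k) (x i)))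
    = (\<Prod>k<n. coeff (R k) k) * (\<Prod>k<n. \<Prod>j<k. x k - x j)"
proof -
  have "\<exists>c. \<forall>k<n. R k = (\<Sum>l\<le>k. smult (c k l) (newton_poly x l)) \<and> c k k = coeff (R k) k"
  proof -
    have "\<forall>k. \<exists>c. k < n \<longrightarrow>
        R k = (\<Sum>l\<le>k. smult (c l) (newton_poly x l)) \<and> c k = coeff (R k) k"
      using newton_expansion[OF deg] by metis
    then show ?thesis by metis
  qed
  then obtain c where
    c: "\<And>k. k < n \<Longrightarrow> R k = (\<Sum>l\<le>k. smult (c k l) (newton_poly x l))"
    and c_diag: "\<And>k. k < n \<Longrightarrow> c k k = coeff (R k) k" by blast
  define L where "L = mat n n (\<lambda>(i, l). poly (newton_poly x l) (x i))"
  define U where "U = mat n n (\<lambda>(l, k). if l \<le> k then c k l else 0)"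
  have [simp]: "L \<in> carrier_mat n n" "U \<in> carrier_mat n n"
    by (auto simp: L_def U_def)
  have "mat n n (\<lambda>(i, k). poly (R k) (x i)) = L * U"
  proof (rule eq_matI)
    fix i k assume "i < dim_row (L * U)" "k < dim_col (L * U)"
    then have ik: "i < n" "k < n" by (simp_all add: L_def U_def)
    have "(L * U) $$ (i, k)
        = (\<Sum>l<n. poly (newton_poly x l) (x i) * (if l \<le> k then c k l else 0))"
      using ik by (simp add: L_def U_def scalar_prod_def lessThan_atLeast0)
    also have "\<dots> = (\<Sum>l\<le>k. poly (newton_poly x l) (x i) * c k l)"
      using ik by (intro sum.mono_neutral_cong_right) auto
    also have "\<dots> = poly (R k) (x i)"
      using ik by (simp add: c poly_sum mult.commute)
    finally show "mat n n (\<lambda>(i, k). poly (R k) (x i)) $$ (i, k) = (L * U) $$ (i, k)"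
      using ik by simp
  qed (simp_all add: L_def U_def)
  moreover have "det L = (\<Prod>k<n. \<Prod>j<k. x k - x j)"
  proof -
    have "det L = prod_list (diag_mat L)"
      by (rule det_lower_triangular[where n = n]) (auto simp: L_def poly_newton_poly_eq_0)
    then show ?thesis
      by (simp add: prod_list_diag_prod L_def poly_newton_poly lessThan_atLeast0)
  qed
  moreover have "det U = (\<Prod>k<n. coeff (R k) k)"
  proof -
    have "det U = prod_list (diag_mat U)"
      by (rule det_upper_triangular[where n = n]) (auto simp: U_def)
    then show ?thesis
      by (simp add: prod_list_diag_prod U_def c_diag lessThan_atLeast0)
  qed
  ultimately show ?thesis by (simp add: det_mult[of L n U] mult.commute)
qed

theorem lemma11:
  fixes P :: "nat \<Rightarrow> complex poly"
    and p :: "nat \<Rightarrow> nat \<Rightarrow> complex"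
    and \<zeta> :: "nat \<Rightarrow> complex"
    and n :: nat
  assumes "\<And>m. P m = monom 1 m + (\<Sum>j = 1..m. monom (p m j) (m - j))"
    and "n \<ge> 1"
  shows "det (skip_matrix P \<zeta> n) =
    (p n 1 + (\<Sum>j = 1..n. \<zeta> j)) *
    (\<Prod>(j, k) \<in> {(j, k). 1 \<le> j \<and> j < k \<and> k \<le> n}. \<zeta> k - \<zeta> j)"
proof -
  obtain m where n: "n = Suc m" using \<open>n \<ge> 1\<close> by (cases n) auto
  define x where "x = (\<lambda>i. \<zeta> (Suc i))"
  define R where "R = (\<lambda>k. if k < m then P k else P n - newton_poly x n)"

  have deg_P: "degree (P k) \<le> k" for k
    unfolding assms(1)
    by (intro degree_add_le degree_sum_le order.trans[OF degree_monom_le]) auto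
  have coeff_P: "coeff (P k) k = 1" for k
  proof -
    have "(\<Sum>j = 1..k. coeff (monom (p k j) (k - j)) k) = 0"
      by (intro sum.neutral) auto
    then show ?thesis by (simp add: assms(1) coeff_sum)
  qed
  have coeff_P_subtop: "coeff (P n) m = p n 1"
  proof -
    have "(\<Sum>j = 1..n. coeff (monom (p n j) (n - j)) m) = (\<Sum>j\<in>{1}. p n j)"
      using n by (intro sum.mono_neutral_cong_right) auto
    then show ?thesis using n by (simp add: assms(1) coeff_sum)
  qed
  have deg_R: "degree (R k) \<le> k" if "k < n" for k
  proof (cases "k < m")
    case True
    then show ?thesis by (simp add: R_def deg_P)
  next
    case False
    with that n have k: "k = m" by simp
    have "coeff (P n - newton_poly x n) i = 0" if "i > m" for i
    proof (cases "i = n")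
      case True
      then show ?thesis by (simp add: coeff_P coeff_newton_poly_top)
    next
      case False
      with that n have "i > n" by simp
      then show ?thesis
        using deg_P[of n] by (simp add: coeff_eq_0 coeff_newton_poly_eq_0)
    qed
    then show ?thesis using k by (auto simp: R_def intro!: degree_le)
  qed

  have "skip_matrix P \<zeta> n = mat n n (\<lambda>(i, k). poly (R k) (x i))"
    unfolding skip_matrix_def
    by (rule cong_mat) (auto simp: n R_def x_def poly_newton_poly_eq_0[where x = "\<lambda>i. \<zeta> (Suc i)"])
  then have "det (skip_matrix P \<zeta> n)
      = (\<Prod>k<n. coeff (R k) k) * (\<Prod>k<n. \<Prod>j<k. x k - x j)"
    using det_poly_values[of n R x] deg_R by simp
  also have "(\<Prod>k<n. coeff (R k) k) = p n 1 + (\<Sum>j = 1..n. \<zeta> j)"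
  proof -
    have "(\<Prod>k<n. coeff (R k) k) = coeff (R m) m"
      by (simp add: n R_def coeff_P)
    also have "\<dots> = p n 1 + (\<Sum>i<n. x i)"
      using coeff_P_subtop by (simp add: R_def n coeff_newton_poly_subtop del: sum.lessThan_Suc)
    also have "(\<Sum>i<n. x i) = (\<Sum>j = 1..n. \<zeta> j)"
      by (simp add: x_def sum.atLeast1_atMost_eq)
    finally show ?thesis .
  qed
  also have "(\<Prod>k<n. \<Prod>j<k. x k - x j)
      = (\<Prod>(j, k) \<in> {(j, k). 1 \<le> j \<and> j < k \<and> k \<le> n}. \<zeta> k - \<zeta> j)"
  proof -
    have "(\<Prod>k<n. \<Prod>j<k. x k - x j) = (\<Prod>(k, j) \<in> (SIGMA k:{..<n}. {..<k}). x k - x j)"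
      by (simp add: prod.Sigma)
    also have "\<dots> = (\<Prod>(j, k) \<in> {(j, k). 1 \<le> j \<and> j < k \<and> k \<le> n}. \<zeta> k - \<zeta> j)"
      by (rule prod.reindex_bij_witness[where
            i = "\<lambda>(j, k). (k - 1, j - 1)" and j = "\<lambda>(k, j). (Suc j, Suc k)"])
        (auto simp: x_def)
    finally show ?thesis .
  qed
  finally show ?thesis .
qed

end
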